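(* Let $L$ be a co-Brouwerian semilattice satisfying the Splitting, Density 1 and Density 2 Axioms. Then for every finite sub-CBS $L_0\subseteq L$ and every signature $(h,G)$ of the first kind in $L_0$, there exists an element $x\in L$ primitive of the first kind over $L_0$ inducing this signature.
   Context: A co-Brouwerian semilattice (CBS) is a poset with least element $0$, binary joins $\vee$ and a difference $-$ characterized by $a-b\le c$ iff $a\le b\vee c$. $a\ll b$ means $a\le b$ and $b-a=b$. Splitting Axiom: for all $a,b_1,b_2$ with $b_1\vee b_2\ll a\ne0$ there exist $a_1,a_2\ne0$ with $a-a_1=a_2\ge b_2$, $a-a_2=a_1\ge b_1$, $b_2-a_1=b_2-b_1$, $b_1-a_2=b_1-b_2$. Density 1 Axiom: for every $c$ there is $b\ne0$ with $c\ll b$. Density 2 Axiom: for all $c,a_1,a_2,d$ with $a_1,a_2\ne0$, $c\ll a_1$, $c\ll a_2$, $a_1-d=a_1$, $a_2-d=a_2$, there is $b\ne0$ with $c\ll b$, $b\ll a_1$, $b\ll a_2$, $b-d=b$. An element $g$ is join-irreducible if for all $n\ge0$, $g\le b_1\vee\dots\vee b_n$ implies $g\le b_i$ for some $i$. A signature of the first kind in a finite CBS $L_0$ is a pair $(h,G)$ with $h\in L_0$ and $G$ a (possibly empty) set of pairwise incomparable join-irreducibles of $L_0$ with $h<g$ for all $g\in G$. An element $x\in L$ is primitive of the first kind over $L_0$ if $x\notin L_0$ and for every join-irreducible $a$ of $L_0$: $a-x\in L_0$, and ($x-a=x$ or $x-a=0$); it induces $(h,G)$ if for every join-irreducible $a$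 of $L_0$: $a<x$ iff $a\le h$, and $x<a$ iff $g\le a$ for some $g\in G$. *)

theory Defs
  imports Main
begin

class co_brouwerian_semilattice = bounded_semilattice_sup_bot + minus +
  assumes diff_le_iff: "a - b \<le> c \<longleftrightarrow> a \<le> sup b c"

definition co_ll :: "'a::co_brouwerian_semilattice \<Rightarrow> 'a \<Rightarrow> bool"  (infix "\<lless>" 50)
  where "a \<lless> b \<longleftrightarrow> a \<le> b \<and> b - a = b"

text \<open>The axioms concern the whole semilattice L, which is the type \<open>'a\<close>; the type
  argument says which one.\<close>

definition splitting_axiom :: "'a::co_brouwerian_semilattice itself \<Rightarrow> bool" where
  "splitting_axiom _ \<longleftrightarrow>
     (\<forall>a b1 b2 :: 'a. sup b1 b2 \<lless> a \<and> a \<noteq> bot \<longrightarrow>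
       (\<exists>a1 a2. a1 \<noteq> bot \<and> a2 \<noteq> bot \<and>
          a - a1 = a2 \<and> a2 \<ge> b2 \<and>
          a - a2 = a1 \<and> a1 \<ge> b1 \<and>
          b2 - a1 = b2 - b1 \<and>
          b1 - a2 = b1 - b2))"

definition density1_axiom :: "'a::co_brouwerian_semilattice itself \<Rightarrow> bool" where
  "density1_axiom _ \<longleftrightarrow> (\<forall>c :: 'a. \<exists>b. b \<noteq> bot \<and> c \<lless> b)"

definition density2_axiom :: "'a::co_brouwerian_semilattice itself \<Rightarrow> bool" where
  "density2_axiom _ \<longleftrightarrow>
     (\<forall>c a1 a2 d :: 'a.
        a1 \<noteq> bot \<and> a2 \<noteq> bot \<and> c \<lless> a1 \<and> c \<lless> a2 \<and> a1 - d = a1 \<and> a2 - d = a2 \<longrightarrow>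
        (\<exists>b. b \<noteq> bot \<and> c \<lless> b \<and> b \<lless> a1 \<and> b \<lless> a2 \<and> b - d = b))"

definition sub_cbs :: "'a::co_brouwerian_semilattice set \<Rightarrow> bool" where
  "sub_cbs L0 \<longleftrightarrow>
     bot \<in> L0 \<and> (\<forall>a\<in>L0. \<forall>b\<in>L0. sup a b \<in> L0) \<and> (\<forall>a\<in>L0. \<forall>b\<in>L0. a - b \<in> L0)"

text \<open>The list \<open>bs\<close> plays the role of \<open>b\<^sub>1, \<dots>, b\<^sub>n\<close> with \<open>n \<ge> 0\<close>; the empty list
  gives \<open>g \<noteq> bot\<close>. Irreducibility is relative to \<open>L0\<close>, not to the ambient semilattice.\<close>

definition join_irreducible_in :: "'a::co_brouwerian_semilattice set \<Rightarrow> 'a \<Rightarrow> bool" where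
  "join_irreducible_in L0 g \<longleftrightarrow>
     g \<in> L0 \<and>
     (\<forall>bs. set bs \<subseteq> L0 \<longrightarrow> g \<le> foldr sup bs bot \<longrightarrow> (\<exists>b\<in>set bs. g \<le> b))"

definition signature_first_kind ::
    "'a::co_brouwerian_semilattice set \<Rightarrow> 'a \<Rightarrow> 'a set \<Rightarrow> bool" where
  "signature_first_kind L0 h G \<longleftrightarrow>
     h \<in> L0 \<and>
     (\<forall>g\<in>G. join_irreducible_in L0 g) \<and>
     (\<forall>g\<in>G. \<forall>g'\<in>G. g \<noteq> g' \<longrightarrow> \<not> g \<le> g' \<and> \<not> g' \<le> g) \<and>
     (\<forall>g\<in>G. h < g)"

definition primitive_first_kind :: "'a::co_brouwerian_semilattice set \<Rightarrow> 'a \<Rightarrow> bool" where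
  "primitive_first_kind L0 x \<longleftrightarrow>
     x \<notin> L0 \<and>
     (\<forall>a. join_irreducible_in L0 a \<longrightarrow> a - x \<in> L0 \<and> (x - a = x \<or> x - a = bot))"

definition induces_first_kind ::
    "'a::co_brouwerian_semilattice set \<Rightarrow> 'a \<Rightarrow> 'a \<Rightarrow> 'a set \<Rightarrow> bool" where
  "induces_first_kind L0 x h G \<longleftrightarrow>
     (\<forall>a. join_irreducible_in L0 a \<longrightarrow>
        (a < x \<longleftrightarrow> a \<le> h) \<and> (x < a \<longleftrightarrow> (\<exists>g\<in>G. g \<le> a)))"

end

theory Submission
  imports Defs
begin

text \<open>Put the new element below all of \<open>G\<close>. Let \<open>c\<close> be the join of \<open>h\<close> and
  the join-irreducibles strictly below every member of \<open>G\<close>, and \<open>d\<close> the join of the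
  join-irreducibles above no member of \<open>G\<close>. The Density Axioms give \<open>b \<noteq> bot\<close> with
  \<open>c \<lless> b\<close>, \<open>b - d = b\<close> and \<open>b \<lless> g\<close> for all \<open>g \<in> G\<close>. Splitting off from \<open>b\<close>, one at
  a time and in decreasing order, the join-irreducibles below \<open>c\<close> but not below \<open>h\<close>
  leaves a part \<open>x\<close> of \<open>b\<close> that contains \<open>h\<close> and cuts nothing off them: \<open>a - x = a\<close>.
  For the join-irreducibles not below \<open>c\<close> the same equality follows from \<open>x \<lless> g\<close>.\<close>

section \<open>Calculus of the difference\<close>

context co_brouwerian_semilattice
begin

lemma diff_le: "a - b \<le> a"
  by (simp add: diff_le_iff)

lemma le_sup_diff: "a \<le> sup b (a - b)"
  using diff_le_iff by blast

lemma diff_mono: "a \<le> a' \<Longrightarrow> b' \<le> b \<Longrightarrow> a - b \<le> a' - b'"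
  by (meson diff_le_iff le_sup_diff order.trans sup.mono order.refl)

lemma diff_eq_bot_iff: "a - b = bot \<longleftrightarrow> a \<le> b"
  using diff_le_iff[of a b bot] by (simp add: bot_unique)

lemma diff_diff: "a - b - c = a - sup b c"
proof (rule order.antisym)
  show "a - b - c \<le> a - sup b c"
    using le_sup_diff[of a "sup b c"] by (simp add: diff_le_iff sup_assoc)
  show "a - sup b c \<le> a - b - c"
    by (metis diff_le_iff order.refl sup_assoc)
qed

lemma diff_eq_self_antimono: "a - b = a \<Longrightarrow> b' \<le> b \<Longrightarrow> a - b' = a"
  using diff_mono[of a a b' b] diff_le[of a b'] by (simp add: order.antisym)

text \<open>The equation \<open>a - d = a\<close> says that \<open>d\<close> cuts nothing off
  \<open>a\<close>. The part \<open>a - b\<close> inherits it because successive differences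
  commute.\<close>

lemma diff_part_eq_self: "a - d = a \<Longrightarrow> a - b - d = a - b"
  by (metis diff_diff sup_commute)

end

lemma co_ll_le: "a \<lless> b \<Longrightarrow> a \<le> b"
  and co_ll_diff: "a \<lless> b \<Longrightarrow> b - a = b"
  by (simp_all add: co_ll_def)

lemma co_ll_le_trans: "a \<le> b \<Longrightarrow> b \<lless> c \<Longrightarrow> a \<lless> c"
  using diff_eq_self_antimono[of c b a] by (auto simp: co_ll_def)

section \<open>Join-irreducibles of a sub-CBS\<close>

lemma join_irreducible_in_mem: "join_irreducible_in L g \<Longrightarrow> g \<in> L"
  by (simp add: join_irreducible_in_def)

lemma join_irreducible_in_ne_bot: "join_irreducible_in L g \<Longrightarrow> g \<noteq> bot"
  by (auto simp: join_irreducible_in_def dest: spec[of _ "[]"])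

lemma join_irreducible_in_le_Sup_fin:
  assumes "join_irreducible_in L g" "finite S" "S \<noteq> {}" "S \<subseteq> L" "g \<le> Sup_fin S"
  shows "\<exists>s\<in>S. g \<le> s"
proof -
  obtain bs where bs: "set bs = S"
    using finite_list[OF \<open>finite S\<close>] by blast
  have "b \<in> set bs \<Longrightarrow> b \<le> foldr sup bs bot" for b
    by (induction bs) (auto intro: le_supI2)
  then have "Sup_fin S \<le> foldr sup bs bot"
    using assms bs by (simp add: Sup_fin.bounded_iff)
  then show ?thesis
    using assms bs unfolding join_irreducible_in_def by (metis order.trans)
qed

lemma join_irreducible_in_le_sup:
  assumes "join_irreducible_in L g" "b \<in> L" "c \<in> L" "g \<le> sup b c"
  shows "g \<le> b \<or> g \<le> c"
  using join_irreducible_in_le_Sup_fin[OF assms(1), of "{b, c}"] assms by auto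

lemma sub_cbs_diff: "sub_cbs L \<Longrightarrow> a \<in> L \<Longrightarrow> b \<in> L \<Longrightarrow> a - b \<in> L"
  by (simp add: sub_cbs_def)

lemma sub_cbs_Sup_fin:
  assumes "sub_cbs L" "finite S" "S \<noteq> {}" "S \<subseteq> L"
  shows "Sup_fin S \<in> L"
  using assms(2-4)
  by (induction rule: finite_ne_induct) (use assms(1) in \<open>auto simp: sub_cbs_def\<close>)

text \<open>Both terms of \<open>g \<le> sup v (g - v)\<close> lie in \<open>L\<close>, so
  irreducibility leaves only \<open>g \<le> g - v\<close>.\<close>

lemma join_irreducible_in_diff:
  assumes "sub_cbs L" "join_irreducible_in L g" "v \<in> L" "\<not> g \<le> v"
  shows "g - v = g"
proof -
  have "g \<le> g - v"
    using join_irreducible_in_le_sup[OF assms(2,3) _ le_sup_diff]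
      sub_cbs_diff[OF assms(1) join_irreducible_in_mem[OF assms(2)] assms(3)] assms(4) by blast
  then show ?thesis
    by (simp add: diff_le order.antisym)
qed

lemma join_irreducible_inI:
  assumes "sub_cbs L" "y \<in> L" "y \<noteq> bot"
    and prime: "\<And>u v. u \<in> L \<Longrightarrow> v \<in> L \<Longrightarrow> y \<le> sup u v \<Longrightarrow> y \<le> u \<or> y \<le> v"
  shows "join_irreducible_in L y"
proof -
  have "\<exists>b\<in>set bs. y \<le> b" if "set bs \<subseteq> L" "y \<le> foldr sup bs bot" for bs
    using that
  proof (induction bs)
    case Nil
    then show ?case using assms(3) by (simp add: bot_unique)
  next
    case (Cons b bs)
    have "foldr sup bs bot \<in> L"
      using Cons.prems(1) by (induction bs) (use assms(1) in \<open>auto simp: sub_cbs_def\<close>)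
    then have "y \<le> b \<or> y \<le> foldr sup bs bot"
      using prime Cons.prems by simp
    then show ?case using Cons by auto
  qed
  then show ?thesis
    using assms(2) by (simp add: join_irreducible_in_def)
qed

text \<open>In a finite sub-CBS every element is a join of join-irreducibles. The induction counts
  the elements of \<open>L\<close> strictly below \<open>y\<close>: a nonzero \<open>y\<close> that
  is not join-irreducible is covered by two smaller elements of \<open>L\<close>.\<close>

lemma le_if_join_irreducibles_le:
  assumes "sub_cbs L" "finite L" "y \<in> L"
    and "\<And>a. join_irreducible_in L a \<Longrightarrow> a \<le> y \<Longrightarrow> a \<le> z"
  shows "y \<le> z"
  using assms(3,4)
proof (induction "card {u \<in> L. u < y}" arbitrary: y rule: less_induct)
  case less
  have IH: "u \<le> z" if "u \<in> L" "u < y" for u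
  proof (rule less.hyps)
    have "{v \<in> L. v < u} \<subset> {v \<in> L. v < y}"
      using that by auto
    then show "card {v \<in> L. v < u} < card {v \<in> L. v < y}"
      using assms(2) by (intro psubset_card_mono) auto
  qed (use that less.prems in \<open>auto intro: order.trans less_imp_le\<close>)
  consider "y = bot" | "join_irreducible_in L y"
    | u v where "y \<noteq> bot" "u \<in> L" "v \<in> L" "y \<le> sup u v" "\<not> y \<le> u" "\<not> y \<le> v"
    using join_irreducible_inI[OF assms(1) less.prems(1)] by blast
  then show ?case
  proof cases
    case 3
    \<comment> \<open>The elements \<open>u\<close> and \<open>v\<close> need not lie below
      \<open>y\<close>. These parts of \<open>y\<close> do, they still cover \<open>y\<close>, and
      they are proper because \<open>y\<close> is below neither \<open>u\<close> nor
      \<open>v\<close>.\<close>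
    let ?p = "y - u" and ?q = "y - (y - u)"
    have "?p \<le> v" "?q \<le> u"
      using 3 le_sup_diff[of y u] by (simp_all add: diff_le_iff sup_commute)
    then have "?p < y" "?q < y"
      using 3 diff_le[of y u] diff_le[of y "y - u"] by (auto simp: order.strict_iff_order)
    moreover have "?p \<in> L" "?q \<in> L"
      using assms(1) less.prems(1) 3 by (simp_all add: sub_cbs_diff)
    ultimately have "sup ?p ?q \<le> z"
      by (simp add: IH)
    then show ?thesis
      using le_sup_diff[of y ?p] by (rule order.trans[rotated])
  qed (use less.prems in auto)
qed

section \<open>Iterating the Splitting and Density 2 Axioms\<close>

text \<open>Induction on \<open>B\<close>, passing from \<open>b\<close> to a part of it at each
  split. The clause over all \<open>d\<close> hands every equation \<open>b - d = b\<close> down to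
  \<open>x\<close>.\<close>

lemma splitting_off_join_irreducibles:
  fixes L :: "'a::co_brouwerian_semilattice set" and h :: 'a
  assumes split: "splitting_axiom TYPE('a)" and L: "sub_cbs L" "finite L" and h: "h \<in> L"
    and B: "\<And>a. a \<in> B \<Longrightarrow> join_irreducible_in L a" "\<And>a. a \<in> B \<Longrightarrow> \<not> a \<le> h"
    and b: "b \<noteq> bot" "Sup_fin (insert h B) \<lless> b"
  shows "\<exists>x. x \<noteq> bot \<and> x \<le> b \<and> h \<le> x \<and> (\<forall>d. b - d = b \<longrightarrow> x - d = x) \<and> (\<forall>a\<in>B. a - x = a)"
proof -
  have "B \<subseteq> L"
    using B(1) join_irreducible_in_mem by blast
  then have "finite B"
    using L(2) finite_subset by blast
  then show ?thesis
    using B b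
  proof (induction B arbitrary: b rule: finite_psubset_induct)
    case (psubset B)
    show ?case
    proof (cases "B = {}")
      case True
      then show ?thesis
        using psubset.prems co_ll_le by auto
    next
      case False
      obtain m where m: "m \<in> B" "\<And>a. a \<in> B \<Longrightarrow> m \<le> a \<Longrightarrow> a = m"
        using finite_has_maximal[OF psubset.hyps(1) False] by metis
      define B' where "B' = B - {m}"
      define s where "s = Sup_fin (insert h B')"
      have fin: "finite B'" and insB: "insert h B = insert m (insert h B')"
        using psubset.hyps(1) m(1) by (auto simp: B'_def)
      have subL: "insert h B' \<subseteq> L"
        using h psubset.prems(1) by (auto simp: B'_def join_irreducible_in_mem)
      have s_L: "s \<in> L"
        unfolding s_def using fin subL by (intro sub_cbs_Sup_fin[OF L(1)]) auto
      \<comment> \<open>By irreducibility \<open>m \<le> s\<close> would put \<open>m\<close> below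
        \<open>h\<close> or below a member of \<open>B'\<close>; the latter contradicts
        maximality.\<close>
      have "\<not> m \<le> s"
        using join_irreducible_in_le_Sup_fin[OF psubset.prems(1)[OF m(1)] _ _ subL] fin m
          psubset.prems(2)[OF m(1)] by (auto simp: B'_def s_def)
      then have m_s: "m - s = m"
        using join_irreducible_in_diff[OF L(1) psubset.prems(1)[OF m(1)] s_L] by simp
      have "Sup_fin (insert h B) = sup s m"
        using fin by (simp add: insB s_def sup_commute)
      then have ll: "sup s m \<lless> b"
        using psubset.prems(4) by simp
      \<comment> \<open>Splitting with \<open>b1 = s\<close> and \<open>b2 = m\<close>. The part
        \<open>a1\<close> is kept: it contains \<open>s\<close>, and
        \<open>m - a1 = m - s = m\<close>, which persists for every
        \<open>x \<le> a1\<close>.\<close>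
      then obtain a1 a2 where a: "a1 \<noteq> bot" "b - a2 = a1" "s \<le> a1" "m - a1 = m - s"
        using split psubset.prems(3) unfolding splitting_axiom_def by metis
      have part: "a1 - d = a1" if "b - d = b" for d
        using diff_part_eq_self[OF that] a(2) by metis
      have "b - s = b"
        using co_ll_diff[OF co_ll_le_trans[OF sup.cobounded1 ll]] .
      then have "s \<lless> a1"
        using a(3) part by (simp add: co_ll_def)
      moreover have "B' \<subset> B"
        using m(1) by (auto simp: B'_def)
      ultimately obtain x where x: "x \<noteq> bot" "x \<le> a1" "h \<le> x"
          "\<And>d. a1 - d = a1 \<Longrightarrow> x - d = x" "\<And>a. a \<in> B' \<Longrightarrow> a - x = a"
        using psubset.IH[of B' a1] psubset.prems(1,2) a(1) unfolding s_def by blast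
      have "m - x = m"
        using diff_eq_self_antimono[OF _ x(2)] a(4) m_s by simp
      moreover have "x \<le> b"
        using x(2) a(2) diff_le[of b a2] by (metis order.trans)
      ultimately show ?thesis
        using x part by (intro exI[of _ x]) (auto simp: B'_def)
    qed
  qed
qed

text \<open>Density 2 bounds by two elements only, so it is applied to the new \<open>g\<close> and
  the \<open>b\<close> found so far; staying below \<open>b\<close> preserves the earlier
  bounds.\<close>

lemma density2_finite:
  fixes G :: "'a::co_brouwerian_semilattice set"
  assumes dens: "density2_axiom TYPE('a)" and "finite G" "G \<noteq> {}"
    and "\<And>g. g \<in> G \<Longrightarrow> g \<noteq> bot" "\<And>g. g \<in> G \<Longrightarrow> c \<lless> g" "\<And>g. g \<in> G \<Longrightarrow> g - d = g"
  shows "\<exists>b. b \<noteq> bot \<and> c \<lless> b \<and> (\<forall>g\<in>G. b \<lless> g) \<and> b - d = b"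
  using assms(2-)
proof (induction G rule: finite_ne_induct)
  case (singleton g)
  then show ?case
    using dens unfolding density2_axiom_def by simp metis
next
  case (insert g G)
  have "\<exists>b. b \<noteq> bot \<and> c \<lless> b \<and> (\<forall>g\<in>G. b \<lless> g) \<and> b - d = b"
    by (rule insert.IH) (use insert.prems in auto)
  then obtain b where b: "b \<noteq> bot" "c \<lless> b" "\<And>g. g \<in> G \<Longrightarrow> b \<lless> g" "b - d = b"
    by blast
  then obtain b' where b': "b' \<noteq> bot" "c \<lless> b'" "b' \<lless> b" "b' \<lless> g" "b' - d = b'"
    using dens insert.prems unfolding density2_axiom_def by (metis insertI1)
  have "b' \<lless> g'" if "g' \<in> G" for g'
    using co_ll_le_trans[OF co_ll_le[OF b'(3)] b(3)[OF that]] .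
  then show ?case
    using b' by blast
qed

section \<open>Construction and verification of the primitive element\<close>

theorem theorem4p9:
  fixes L0 :: "'a::co_brouwerian_semilattice set" and h :: 'a and G :: "'a set"
  assumes "splitting_axiom TYPE('a)"
    and "density1_axiom TYPE('a)"
    and "density2_axiom TYPE('a)"
    and "finite L0" and "sub_cbs L0"
    and "signature_first_kind L0 h G"
  shows "\<exists>x. primitive_first_kind L0 x \<and> induces_first_kind L0 x h G"
proof -
  let ?ji = "join_irreducible_in L0"
  have h: "h \<in> L0" and G: "\<And>g. g \<in> G \<Longrightarrow> ?ji g" "\<And>g. g \<in> G \<Longrightarrow> h < g"
    using assms(6) by (auto simp: signature_first_kind_def)
  define C where "C = insert h {a. ?ji a \<and> (\<forall>g\<in>G. a < g)}"
  \<comment> \<open>Inserting \<open>bot\<close> keeps \<open>D\<close> nonempty for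
    \<open>Sup_fin\<close> without changing the join. For empty \<open>G\<close>, both
    \<open>C\<close> and \<open>D\<close> contain all join-irreducibles.\<close>
  define D where "D = insert bot {a. ?ji a \<and> (\<forall>g\<in>G. \<not> g \<le> a)}"
  define c where "c = Sup_fin C"
  define d where "d = Sup_fin D"
  have sub: "C \<subseteq> L0" "D \<subseteq> L0" "G \<subseteq> L0"
    using h G(1) assms(5) by (auto simp: C_def D_def join_irreducible_in_mem sub_cbs_def)
  have fin: "finite C" "finite D" "finite G"
    using sub assms(4) by (blast intro: finite_subset)+
  have ne: "C \<noteq> {}" "D \<noteq> {}"
    by (auto simp: C_def D_def)
  have cd_L0: "c \<in> L0" "d \<in> L0"
    unfolding c_def d_def using sub_cbs_Sup_fin[OF assms(5)] fin ne sub by auto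
  have c_le: "c \<lless> g" and diff_d: "g - d = g" if "g \<in> G" for g
  proof -
    have "\<not> g \<le> s" if "s \<in> C" for s
      using that \<open>g \<in> G\<close> G(2)[OF \<open>g \<in> G\<close>] by (auto simp: C_def leD)
    then have "\<not> g \<le> c"
      unfolding c_def
      using join_irreducible_in_le_Sup_fin[OF G(1)[OF that] fin(1) ne(1) sub(1)] by blast
    moreover have "c \<le> g"
      unfolding c_def Sup_fin.bounded_iff[OF fin(1) ne(1)]
      using that G(2) by (auto simp: C_def less_imp_le)
    ultimately show "c \<lless> g"
      using join_irreducible_in_diff[OF assms(5) G(1)[OF that] cd_L0(1)] by (simp add: co_ll_def)
    have "\<not> g \<le> s" if "s \<in> D" for s
      using that \<open>g \<in> G\<close> join_irreducible_in_ne_bot[OF G(1)[OF \<open>g \<in> G\<close>]]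
      by (auto simp: D_def bot_unique)
    then have "\<not> g \<le> d"
      unfolding d_def
      using join_irreducible_in_le_Sup_fin[OF G(1)[OF that] fin(2) ne(2) sub(2)] by blast
    then show "g - d = g"
      using join_irreducible_in_diff[OF assms(5) G(1)[OF that] cd_L0(2)] by simp
  qed
  obtain b where b: "b \<noteq> bot" "c \<lless> b" "\<And>g. g \<in> G \<Longrightarrow> b \<lless> g" "b - d = b"
  proof (cases "G = {}")
    case True
    \<comment> \<open>With no upper bounds to respect, Density 1 above \<open>sup c d\<close> yields
      \<open>c \<lless> b\<close> and \<open>b - d = b\<close> together.\<close>
    obtain b where b: "b \<noteq> bot" "sup c d \<lless> b"
      using assms(2) unfolding density1_axiom_def by blast
    then have "c \<lless> b" "d \<lless> b"
      using co_ll_le_trans[OF sup.cobounded1] co_ll_le_trans[OF sup.cobounded2] by blast+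
    then show ?thesis
      using b(1) True that co_ll_diff by blast
  next
    case False
    then show ?thesis
      using density2_finite[OF assms(3) fin(3) False, of c d] c_le diff_d
        G(1) join_irreducible_in_ne_bot that by metis
  qed
  define B where "B = {a \<in> C. \<not> a \<le> h}"
  have "Sup_fin (insert h B) \<le> c"
    unfolding c_def using fin(1) by (intro Sup_fin.subset_imp) (auto simp: B_def C_def)
  then have "Sup_fin (insert h B) \<lless> b"
    using b(2) co_ll_le_trans by blast
  moreover have "?ji a" "\<not> a \<le> h" if "a \<in> B" for a
    using that by (auto simp: B_def C_def)
  ultimately obtain x where x: "x \<noteq> bot" "x \<le> b" "h \<le> x"
      "\<And>d. b - d = b \<Longrightarrow> x - d = x" "\<And>a. a \<in> B \<Longrightarrow> a - x = a"
    using splitting_off_join_irreducibles[OF assms(1,5,4) h _ _ b(1), of B] by blast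
  have x_ll: "x \<lless> g" if "g \<in> G" for g
    using co_ll_le_trans[OF x(2) b(3)[OF that]] .
  \<comment> \<open>If \<open>a\<close> is not strictly below some \<open>g\<close> in
    \<open>G\<close>, then either \<open>a = g\<close>, settled by \<open>x \<lless> g\<close>, or
    \<open>a - g = a\<close>, and \<open>x \<le> g\<close> cuts off even less.\<close>
  have diff_x: "a - x = a" if a: "?ji a" "\<not> a \<le> h" for a
  proof (cases "\<forall>g\<in>G. a < g")
    case True
    then show ?thesis
      using x(5) a by (simp add: B_def C_def)
  next
    case False
    then obtain g where g: "g \<in> G" "\<not> a < g"
      by blast
    show ?thesis
    proof (cases "a = g")
      case True
      then show ?thesis
        using co_ll_diff[OF x_ll] g(1) by simp
    next
      case False
      then have "a - g = a"
        using join_irreducible_in_diff[OF assms(5) a(1)] g sub(3) by (auto simp: less_le)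
      then show ?thesis
        using diff_eq_self_antimono co_ll_le[OF x_ll[OF g(1)]] by blast
    qed
  qed
  have below: "a \<le> x \<longleftrightarrow> a \<le> h" if "?ji a" for a
    using diff_x[OF that] x(3) join_irreducible_in_ne_bot[OF that]
      diff_eq_bot_iff[of a x] order.trans by metis
  \<comment> \<open>If \<open>x\<close> were in \<open>L0\<close>, its join-irreducibles would force
    \<open>x \<le> h \<le> c\<close>; but \<open>b - c = b\<close> passes to \<open>x\<close>, so
    \<open>x - x = x\<close> and \<open>x = bot\<close>.\<close>
  have notin: "x \<notin> L0"
  proof
    assume "x \<in> L0"
    then have "x \<le> h"
      using le_if_join_irreducibles_le[OF assms(5,4)] below by blast
    moreover have "h \<le> c"
      unfolding c_def using fin(1) by (intro Sup_fin.coboundedI) (auto simp: C_def)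
    ultimately have "x - x = x"
      using x(4) b(2) co_ll_diff diff_eq_self_antimono order.trans by metis
    then show False
      using x(1) diff_eq_bot_iff[of x x] by simp
  qed
  have disj: "x - a = x" if "?ji a" "\<not> (\<exists>g\<in>G. g \<le> a)" for a
  proof -
    have "a \<le> d"
      unfolding d_def using fin(2) that by (intro Sup_fin.coboundedI) (auto simp: D_def)
    then show ?thesis
      using x(4)[OF b(4)] diff_eq_self_antimono by blast
  qed
  have above: "x \<le> a \<longleftrightarrow> (\<exists>g\<in>G. g \<le> a)" if "?ji a" for a
    using disj[OF that] x(1) co_ll_le[OF x_ll] order.trans diff_eq_bot_iff[of x a] by metis
  have "primitive_first_kind L0 x"
    unfolding primitive_first_kind_def
  proof (intro conjI allI impI)
    fix a assume a: "?ji a"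
    show "a - x \<in> L0"
    proof (cases "a \<le> h")
      case True
      then have "a - x = bot"
        using below[OF a] diff_eq_bot_iff by blast
      then show ?thesis
        using assms(5) by (simp add: sub_cbs_def)
    next
      case False
      then show ?thesis
        using diff_x[OF a] join_irreducible_in_mem[OF a] by simp
    qed
    show "x - a = x \<or> x - a = bot"
      using disj[OF a] above[OF a] diff_eq_bot_iff by blast
  qed (rule notin)
  \<comment> \<open>The inequalities of \<open>below\<close> and \<open>above\<close> are strict
    because \<open>a\<close> lies in \<open>L0\<close> and \<open>x\<close> does not.\<close>
  moreover have "induces_first_kind L0 x h G"
    unfolding induces_first_kind_def less_le
    using below above notin join_irreducible_in_mem by blast
  ultimately show ?thesis
    by blast
qed

end
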